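(* Let $1<\alpha<2$ be irrational, let $\beta$ satisfy $1/\alpha+1/\beta=1$, and let $f$ be the Beatty constraint function parameterized by $\alpha$. Consider the modified 2-pile subtraction game with constraint function $f$. Then the set of $P$-positions of this game is $\{([n\alpha],[n\beta]) \mid n\in\mathbb{Z}_{\ge 0}\}$ if and only if $2\min f-\max f\geq 1$, where the minimum and maximum of $f$ are taken over the positive integers.
   Context: $[\cdot]$ denotes the floor function. Beatty constraint function: for irrational $1<\alpha<2$ and $\beta$ with $1/\alpha+1/\beta=1$, the sequences $([n\alpha])_{n\ge1}$ and $([n\beta])_{n\ge 1}$ partition the positive integers, and the Beatty constraint function parameterized by $\alpha$ is defined on positive integers by $$f([n\alpha])=f([n\beta])=([n\beta]-[(n-1)\beta])-([n\alpha]-[(n-1)\alpha]),\qquad n\ge 1.$$ Modified 2-pile subtraction game with integer-valued constraint function $f$ depending only on $x_0$: a position consists of two piles of tokens and is written $(x,y)$ with $0\le x\le y<\infty$ (the smaller pile is always listed first). Two players alternate; on each turn the player does one of the following. (aa) Remove any positive number of tokens from a single pile, possibly the entire pile. (bb) Remove a positive number of tokens from each pile, moving from $(x_0,y_0)$ to $(x_1,y_1)$ (so $0\le x_1<x_0$, $0\le y_1<y_0$), where $|(y_0-y_1)-(x_0-x_1)|<f(x_0)$. The player who leaves both piles empty wins (normal play). A position is an $N$-position if the player moving from it has a winning strategy, and a $P$-position otherwise. *)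

theory Defs
  imports Complex_Main
begin

section \<open>The Beatty constraint function\<close>

definition beatty :: "real \<Rightarrow> nat \<Rightarrow> nat" where
  "beatty \<gamma> n = nat \<lfloor>real n * \<gamma>\<rfloor>"

text \<open>
  For each positive \<open>m\<close> the index \<open>n\<close> below is unique because the two Beatty sequences
  partition the positive integers; see \<open>beatty_constraint_beatty\<close> for the resulting equations.
  The value at \<open>0\<close> is junk and is never used.
\<close>

definition beatty_constraint :: "real \<Rightarrow> real \<Rightarrow> nat \<Rightarrow> int" where
  "beatty_constraint \<alpha> \<beta> m =
    (let n = (THE n. n \<ge> 1 \<and> (m = beatty \<alpha> n \<or> m = beatty \<beta> n))
     in (int (beatty \<beta> n) - int (beatty \<beta> (n - 1))) -
        (int (beatty \<alpha> n) - int (beatty \<alpha> (n - 1))))"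

section \<open>The modified 2-pile subtraction game\<close>

definition position :: "nat \<times> nat \<Rightarrow> bool" where
  "position p \<longleftrightarrow> fst p \<le> snd p"

definition sort_piles :: "nat \<times> nat \<Rightarrow> nat \<times> nat" where
  "sort_piles p = (min (fst p) (snd p), max (fst p) (snd p))"

text \<open>
  The variables \<open>x1\<close> and \<open>y1\<close> are what is left of the piles \<open>x0\<close> and \<open>y0\<close>, so they may
  come out in the wrong order; the resulting position lists the smaller pile first.
  Demanding \<open>x1 \<le> y1\<close> in rule \<open>both\<close> would give the same moves, see \<open>move_iff\<close>.
\<close>

inductive move :: "(nat \<Rightarrow> int) \<Rightarrow> nat \<times> nat \<Rightarrow> nat \<times> nat \<Rightarrow> bool" for f where
  small: "\<lbrakk>x0 \<le> y0; x1 < x0\<rbrakk> \<Longrightarrow> move f (x0, y0) (sort_piles (x1, y0))"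
| large: "\<lbrakk>x0 \<le> y0; y1 < y0\<rbrakk> \<Longrightarrow> move f (x0, y0) (sort_piles (x0, y1))"
| both: "\<lbrakk>x0 \<le> y0; x1 < x0; y1 < y0;
          \<bar>(int y0 - int y1) - (int x0 - int x1)\<bar> < f x0\<rbrakk>
         \<Longrightarrow> move f (x0, y0) (sort_piles (x1, y1))"

text \<open>
  \<open>wins_with f \<sigma> p\<close>: from \<open>p\<close>, the player to move wins every play in which they follow
  the strategy \<open>\<sigma>\<close>. Being inductive, this includes that each such play is finite.
\<close>

inductive wins_with ::
  "(nat \<Rightarrow> int) \<Rightarrow> (nat \<times> nat \<Rightarrow> nat \<times> nat) \<Rightarrow> nat \<times> nat \<Rightarrow> bool"
  for f \<sigma> where
  empties: "\<lbrakk>move f p (\<sigma> p); \<sigma> p = (0, 0)\<rbrakk> \<Longrightarrow> wins_with f \<sigma> p"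
| continues: "\<lbrakk>move f p (\<sigma> p); \<sigma> p \<noteq> (0, 0); \<And>q. move f (\<sigma> p) q \<Longrightarrow> wins_with f \<sigma> q\<rbrakk>
              \<Longrightarrow> wins_with f \<sigma> p"

definition N_positions :: "(nat \<Rightarrow> int) \<Rightarrow> (nat \<times> nat) set" where
  "N_positions f = {p. position p \<and> (\<exists>\<sigma>. wins_with f \<sigma> p)}"

definition P_positions :: "(nat \<Rightarrow> int) \<Rightarrow> (nat \<times> nat) set" where
  "P_positions f = {p. position p \<and> p \<notin> N_positions f}"

section \<open>Sanity checks\<close>

lemma beatty_strict:
  assumes "\<gamma> > 1" and "\<gamma> \<notin> \<rat>" and "n \<ge> 1"
  shows "real (beatty \<gamma> n) < real n * \<gamma>" and "real n * \<gamma> < real (beatty \<gamma> n) + 1"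
proof -
  have nonneg: "0 \<le> \<lfloor>real n * \<gamma>\<rfloor>"
    using assms(1) by simp
  have eq: "real (beatty \<gamma> n) = of_int \<lfloor>real n * \<gamma>\<rfloor>"
    unfolding beatty_def using nonneg by simp
  have "real n * \<gamma> \<noteq> of_int k" for k
  proof
    assume "real n * \<gamma> = of_int k"
    hence "\<gamma> = of_int k / real n"
      using assms(3) by (simp add: field_simps)
    hence "\<gamma> \<in> \<rat>"
      by simp
    with assms(2) show False ..
  qed
  thus "real (beatty \<gamma> n) < real n * \<gamma>"
    unfolding eq by (metis of_int_floor_le order_le_less)
  show "real n * \<gamma> < real (beatty \<gamma> n) + 1"
    unfolding eq by linarith
qed

lemma beatty_inj:
  assumes "\<gamma> > 1" and "beatty \<gamma> m = beatty \<gamma> n"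
  shows "m = n"
proof -
  have *: "beatty \<gamma> i < beatty \<gamma> j" if "i < j" for i j
  proof -
    have "real i + 1 \<le> real j"
      using that by linarith
    hence "(real i + 1) * \<gamma> \<le> real j * \<gamma>"
      using assms(1) by (intro mult_right_mono) auto
    hence "real i * \<gamma> + 1 \<le> real j * \<gamma>"
      using assms(1) by (simp add: algebra_simps)
    hence "\<lfloor>real i * \<gamma>\<rfloor> < \<lfloor>real j * \<gamma>\<rfloor>"
      by linarith
    moreover have "0 \<le> \<lfloor>real i * \<gamma>\<rfloor>"
      using assms(1) by simp
    ultimately show ?thesis
      unfolding beatty_def by linarith
  qed
  show ?thesis
    using *[of m n] *[of n m] assms(2) by (cases m n rule: linorder_cases) auto
qed

lemma beatty_disjoint:
  assumes "1 < \<alpha>" "\<alpha> < 2" "\<alpha> \<notin> \<rat>" "1 / \<alpha> + 1 / \<beta> = 1" "m \<ge> 1" "n \<ge> 1"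
  shows "\<beta> > 1" "\<beta> \<notin> \<rat>" "beatty \<alpha> m \<noteq> beatty \<beta> n"
proof -
  have \<beta>: "1 / \<beta> = 1 - 1 / \<alpha>"
    using assms(4) by simp
  have "1 / \<alpha> < 1" "0 < 1 / \<alpha>"
    using assms(1) by auto
  hence 1: "0 < 1 / \<beta>" "1 / \<beta> < 1"
    unfolding \<beta> by auto
  thus gt: "\<beta> > 1"
    by (simp add: field_simps split: if_splits)
  show irr: "\<beta> \<notin> \<rat>"
  proof
    assume "\<beta> \<in> \<rat>"
    hence "1 / (1 - 1 / \<beta>) \<in> \<rat>"
      by simp
    moreover have "1 / (1 - 1 / \<beta>) = \<alpha>"
      unfolding \<beta> by simp
    ultimately show False
      using assms(3) by simp
  qed
  show "beatty \<alpha> m \<noteq> beatty \<beta> n"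
  proof
    assume eq: "beatty \<alpha> m = beatty \<beta> n"
    define k where "k = beatty \<alpha> m"
    note a = beatty_strict[OF assms(1,3,5), folded k_def]
    note b = beatty_strict[OF gt irr assms(6), folded eq, folded k_def]
    have "real k * (1 / \<alpha>) < real m" "real k * (1 / \<beta>) < real n"
         "real m < (real k + 1) * (1 / \<alpha>)" "real n < (real k + 1) * (1 / \<beta>)"
      using a b assms(1) gt by (simp_all add: field_simps)
    hence "real k * (1 / \<alpha> + 1 / \<beta>) < real m + real n"
          "real m + real n < (real k + 1) * (1 / \<alpha> + 1 / \<beta>)"
      unfolding distrib_left by linarith+
    hence "real k < real (m + n)" "real (m + n) < real (k + 1)"
      unfolding assms(4) by simp_all
    hence "k < m + n" "m + n < k + 1"
      unfolding of_nat_less_iff .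
    thus False
      by simp
  qed
qed

lemma beatty_constraint_beatty:
  assumes "1 < \<alpha>" "\<alpha> < 2" "\<alpha> \<notin> \<rat>" "1 / \<alpha> + 1 / \<beta> = 1" "n \<ge> 1"
  defines "v \<equiv> (\<lfloor>real n * \<beta>\<rfloor> - \<lfloor>(real n - 1) * \<beta>\<rfloor>) - (\<lfloor>real n * \<alpha>\<rfloor> - \<lfloor>(real n - 1) * \<alpha>\<rfloor>)"
  shows "beatty_constraint \<alpha> \<beta> (beatty \<alpha> n) = v"
    and "beatty_constraint \<alpha> \<beta> (beatty \<beta> n) = v"
proof -
  note D = beatty_disjoint[OF assms(1-4)]
  have gt: "\<beta> > 1"
    using D(1)[of 1 1] by simp
  have int_beatty: "int (beatty \<gamma> i) = \<lfloor>real i * \<gamma>\<rfloor>" if "\<gamma> > 1" for \<gamma> i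
    unfolding beatty_def using that by simp
  have v: "v = (int (beatty \<beta> n) - int (beatty \<beta> (n - 1))) -
               (int (beatty \<alpha> n) - int (beatty \<alpha> (n - 1)))"
    unfolding v_def int_beatty[OF gt] int_beatty[OF assms(1)]
    using assms(5) by (simp add: of_nat_diff)
  have "(THE k. k \<ge> 1 \<and> (beatty \<alpha> n = beatty \<alpha> k \<or> beatty \<alpha> n = beatty \<beta> k)) = n"
    using assms(5) beatty_inj[OF assms(1)] D(3) by (intro the_equality) auto
  thus "beatty_constraint \<alpha> \<beta> (beatty \<alpha> n) = v"
    unfolding beatty_constraint_def v Let_def by simp
  have "(THE k. k \<ge> 1 \<and> (beatty \<beta> n = beatty \<alpha> k \<or> beatty \<beta> n = beatty \<beta> k)) = n"
    using assms(5) beatty_inj[OF gt] D(3) by (intro the_equality) (auto dest: sym)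
  thus "beatty_constraint \<alpha> \<beta> (beatty \<beta> n) = v"
    unfolding beatty_constraint_def v Let_def by simp
qed

lemma finite_range_beatty_constraint:
  assumes "\<alpha> > 1" "\<beta> > 1"
  shows "finite (beatty_constraint \<alpha> \<beta> ` A)"
proof (rule finite_subset)
  have *: "int (beatty \<gamma> n) - int (beatty \<gamma> (n - 1)) \<in> {0..\<lceil>\<gamma>\<rceil> + 1}" if "\<gamma> > 1" for \<gamma> n
  proof (cases n)
    case 0
    thus ?thesis
      using that by simp
  next
    case (Suc k)
    have "real n * \<gamma> = real k * \<gamma> + \<gamma>"
      using Suc by (simp add: algebra_simps)
    moreover have "int (beatty \<gamma> i) = \<lfloor>real i * \<gamma>\<rfloor>" for i
      unfolding beatty_def using that by simp
    ultimately show ?thesis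
      using that Suc by simp linarith
  qed
  show "beatty_constraint \<alpha> \<beta> ` A \<subseteq> {-(\<lceil>\<alpha>\<rceil> + 1)..\<lceil>\<beta>\<rceil> + 1}"
  proof
    fix z assume "z \<in> beatty_constraint \<alpha> \<beta> ` A"
    then obtain n where
      "z = (int (beatty \<beta> n) - int (beatty \<beta> (n - 1))) -
           (int (beatty \<alpha> n) - int (beatty \<alpha> (n - 1)))"
      unfolding beatty_constraint_def Let_def by blast
    thus "z \<in> {-(\<lceil>\<alpha>\<rceil> + 1)..\<lceil>\<beta>\<rceil> + 1}"
      using *[OF assms(1), of n] *[OF assms(2), of n] by auto
  qed
qed simp

lemma move_iff:
  assumes "x0 \<le> y0" "x1 \<le> y1"
  shows "move f (x0, y0) (x1, y1) \<longleftrightarrow>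
    (\<exists>x<x0. (x1, y1) = sort_piles (x, y0)) \<or> (\<exists>y<y0. (x1, y1) = sort_piles (x0, y)) \<or>
    (x1 < x0 \<and> y1 < y0 \<and> \<bar>(int y0 - int y1) - (int x0 - int x1)\<bar> < f x0)"
    (is "?L \<longleftrightarrow> ?R")
proof
  assume ?L
  thus ?R
    using assms
    by cases (fastforce simp: sort_piles_def min_def max_def split: if_splits)+
next
  assume ?R
  moreover have "sort_piles (x1, y1) = (x1, y1)"
    using assms(2) by (simp add: sort_piles_def)
  ultimately show ?L
    using assms(1) move.small[of x0 y0 _ f] move.large[of x0 y0 _ f] move.both[of x0 y0 x1 y1 f] by metis
qed

lemma move_position: "move f p q \<Longrightarrow> position p \<and> position q"
  by (cases rule: move.cases) (auto simp: position_def sort_piles_def)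

end

theory Submission
  imports Defs "HOL-Analysis.Kronecker_Approximation_Theorem"
begin

text \<open>
  Write \<open>a n\<close> and \<open>b n\<close> for the Beatty sequences of \<open>\<alpha>\<close> and \<open>\<beta>\<close>, \<open>d n = b n - a n\<close>, and
  \<open>g n = d n - d (n - 1)\<close>, which is the value of the constraint function at both \<open>a n\<close> and
  \<open>b n\<close>. The set of P-positions is the only kernel of the move graph, so the question is when
  the pairs \<open>(a n, b n)\<close> form a kernel (\<open>P_positions_eq_iff_kernel\<close>). The inequality on the
  minimum and the maximum says that \<open>g m < 2 * g n\<close> for all positive \<open>m\<close> and \<open>n\<close>
  (\<open>condition_iff\<close>).

  Assume that inequality. Then \<open>d\<close> increases strictly, and no pair is reached from another one.
  The only delicate positions off the pairs are \<open>(a n, y)\<close> with \<open>a n \<le> y < b n\<close>. Their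
  difference \<open>y - a n\<close> lies between two consecutive values of \<open>d\<close>, whose distance is some
  \<open>g m\<close>; being less than \<open>2 * g n\<close>, this distance forces one of the two values to be closer than
  \<open>g n\<close> to the difference, and the corresponding pair can be reached (\<open>move_to_some_pair\<close>).

  Conversely, let the pairs form a kernel. All values of \<open>g\<close> are positive and lie in
  \<open>{\<lfloor>\<beta>\<rfloor> - 2..\<lfloor>\<beta>\<rfloor>}\<close>, so the inequality can only fail for \<open>\<lfloor>\<beta>\<rfloor>\<close> equal to 2, 3 or 4.
  Whenever \<open>2 * g n \<le> g m\<close> and \<open>m \<le> n\<close>, there is a number \<open>D\<close> between \<open>d (m - 1)\<close> and \<open>d m\<close>
  whose distance to every value of \<open>d\<close> is at least \<open>g n\<close>. From \<open>(a n, a n + D)\<close> the only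
  remaining way to a pair is to shrink the smaller pile, so \<open>a n + D\<close> has to be some \<open>b i\<close> (\<open>kernel_gap_forces_b\<close>). For
  \<open>\<lfloor>\<beta>\<rfloor> \<le> 3\<close> this produces two values of \<open>b\<close> which are too close to each other.

  For \<open>\<lfloor>\<beta>\<rfloor> = 4\<close> it only produces an inequality between the fractional parts belonging to \<open>m\<close>
  and \<open>n\<close>, whenever \<open>g m = 4\<close> and \<open>g n = 2\<close> (\<open>kernel_window\<close>). The conditions \<open>g m = 4\<close> and
  \<open>g n = 2\<close> place the points \<open>((m - 1) \<alpha>, (m - 1) \<beta>)\<close> and \<open>(n \<alpha>, n \<beta>)\<close>, taken modulo 1, in
  two open rectangles. By recurrence of the orbit of \<open>(\<alpha>, \<beta>)\<close> on the torus the inequality holds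
  for all integer indices, negative ones included, and in any order (\<open>kernel_window_int\<close>). The
  points of the orbit can then be pushed along the line spanned by a small multiple of \<open>(\<alpha>, \<beta>)\<close>
  modulo 1: pushing the second point forwards and the first one backwards until they are about
  to leave their rectangles contradicts the inequality. The argument rests on recurrence rather
  than density, because a rational relation between 1, \<open>\<alpha>\<close> and \<open>\<beta>\<close> may confine the orbit to
  finitely many closed curves.
\<close>

section \<open>P-positions as a kernel of the move graph\<close>

lemma move_decreases: "move f p q \<Longrightarrow> fst q + snd q < fst p + snd p"
  by (cases rule: move.cases) (auto simp: sort_piles_def min_def max_def)

text \<open>
  Winning without reference to a strategy: the player moves to a position all of whose options
  are winning again. Here every reply of the opponent may be answered independently, whereas
  \<open>wins_with\<close> asks for one strategy that handles all of them.
\<close>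
inductive winning :: "(nat \<Rightarrow> int) \<Rightarrow> nat \<times> nat \<Rightarrow> bool" for f where
  winningI: "move f p q \<Longrightarrow> (\<forall>r. move f q r \<longrightarrow> winning f r) \<Longrightarrow> winning f p"

text \<open>
  The definition of \<open>winning\<close> looks two moves ahead. Since play terminates, it agrees with the
  usual recursion, which looks one move ahead.
\<close>
lemma not_winning_iff: "\<not> winning f p \<longleftrightarrow> (\<forall>q. move f p q \<longrightarrow> winning f q)"
proof (induction "fst p + snd p" arbitrary: p rule: less_induct)
  case less
  have IH: "\<not> winning f q \<longleftrightarrow> (\<forall>r. move f q r \<longrightarrow> winning f r)" if "move f p q" for q
    using less.hyps[OF move_decreases[OF that]] .
  have "winning f p \<longleftrightarrow> (\<exists>q. move f p q \<and> (\<forall>r. move f q r \<longrightarrow> winning f r))"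
    by (subst winning.simps) blast
  thus ?case
    using IH by blast
qed

lemma no_move_from_origin: "\<not> move f (0, 0) q"
  using move_decreases[of f "(0, 0)" q] by auto

lemma wins_with_imp_winning: "wins_with f \<sigma> p \<Longrightarrow> winning f p"
proof (induction rule: wins_with.induct)
  case (empties p)
  then show ?case
    using no_move_from_origin winningI[of f p "\<sigma> p"] by auto
next
  case (continues p)
  then show ?case
    using winningI[of f p "\<sigma> p"] by blast
qed

text \<open>
  The answers at the various winning positions do not interfere, so choosing a good move once
  and for all at each of them gives a single strategy.
\<close>
lemma winning_imp_wins_with: 
  assumes "winning f p"
  shows "\<exists>\<sigma>. wins_with f \<sigma> p"
proof -
  define \<sigma> where "\<sigma> = (\<lambda>p. SOME q. move f p q \<and> (\<forall>r. move f q r \<longrightarrow> winning f r))"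
  have \<sigma>: "move f p (\<sigma> p) \<and> (\<forall>r. move f (\<sigma> p) r \<longrightarrow> winning f r)" if "winning f p" for p
    unfolding \<sigma>_def by (rule someI_ex) (use that in \<open>cases, blast\<close>)
  have "winning f p \<Longrightarrow> wins_with f \<sigma> p" for p
  proof (induction "fst p + snd p" arbitrary: p rule: less_induct)
    case less
    have step: "move f p (\<sigma> p)" and reply: "\<And>r. move f (\<sigma> p) r \<Longrightarrow> winning f r"
      using \<sigma>[OF less.prems] by auto
    have "wins_with f \<sigma> r" if "move f (\<sigma> p) r" for r
      using less.hyps[of r] reply[OF that] move_decreases[OF step] move_decreases[OF that] by simp
    thus ?case
      using wins_with.empties[of f p \<sigma>] wins_with.continues[of f p \<sigma>] step by blast
  qed
  thus ?thesis
    using assms by blast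
qed

text \<open>
  Every move decreases the number of tokens, so the move graph is well-founded and a kernel, a
  set that contains a position exactly if no move leads from it into the set, is unique; the
  P-positions are a kernel by \<open>not_winning_iff\<close>.
\<close>
lemma P_positions_eq_iff_kernel:
  assumes pos: "\<And>p. p \<in> S \<Longrightarrow> position p"
  shows "P_positions f = S \<longleftrightarrow>
    (\<forall>p. position p \<longrightarrow> (p \<in> S \<longleftrightarrow> (\<forall>q. move f p q \<longrightarrow> q \<notin> S)))"
proof -
  have P: "P_positions f = {p. position p \<and> \<not> winning f p}"
    unfolding P_positions_def N_positions_def
    using wins_with_imp_winning winning_imp_wins_with by blast
  show ?thesis
  proof
    assume "P_positions f = S"
    hence S: "p \<in> S \<longleftrightarrow> position p \<and> \<not> winning f p" for p
      using P by blast
    show "\<forall>p. position p \<longrightarrow> (p \<in> S \<longleftrightarrow> (\<forall>q. move f p q \<longrightarrow> q \<notin> S))"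
    proof (intro allI impI)
      fix p assume "position p"
      hence "p \<in> S \<longleftrightarrow> (\<forall>q. move f p q \<longrightarrow> winning f q)"
        unfolding S using not_winning_iff[of f p] by blast
      thus "p \<in> S \<longleftrightarrow> (\<forall>q. move f p q \<longrightarrow> q \<notin> S)"
        unfolding S using move_position[of f p] by blast
    qed
  next
    assume kernel: "\<forall>p. position p \<longrightarrow> (p \<in> S \<longleftrightarrow> (\<forall>q. move f p q \<longrightarrow> q \<notin> S))"
    have "position p \<Longrightarrow> p \<in> S \<longleftrightarrow> \<not> winning f p" for p
    proof (induction "fst p + snd p" arbitrary: p rule: less_induct)
      case less
      have "q \<in> S \<longleftrightarrow> \<not> winning f q" if "move f p q" for q
        using less.hyps move_decreases[OF that] move_position[OF that] by blast
      thus ?case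
        using kernel less.prems not_winning_iff[of f p] by blast
    qed
    thus "P_positions f = S"
      using P pos by blast
  qed
qed

section \<open>Recurrence on the torus\<close>

lemma irrational_multiple:
  fixes \<gamma> :: real
  assumes "\<gamma> \<notin> \<rat>" "z \<noteq> 0"
  shows "of_int z * \<gamma> \<notin> \<int>"
proof
  assume "of_int z * \<gamma> \<in> \<int>"
  hence "of_int z * \<gamma> / of_int z \<in> \<rat>"
    using Ints_subset_Rats by (intro Rats_divide) auto
  thus False
    using assms by simp
qed

lemma small_simultaneous_multiple:
  fixes \<alpha> \<beta> \<epsilon> :: real
  assumes "0 < \<epsilon>"
  obtains N p q :: int where "0 < N" "\<bar>of_int N * \<alpha> - of_int p\<bar> < \<epsilon>" "\<bar>of_int N * \<beta> - of_int q\<bar> < \<epsilon>"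
proof -
  obtain M :: nat where M: "0 < M" "1 / real M < \<epsilon>"
    using nat_approx_posE[OF assms] by (metis of_nat_Suc zero_less_Suc)
  obtain N r where N: "0 < N" and
    r: "\<And>i :: nat. i < 2 \<Longrightarrow> \<bar>of_int N * (if i = 0 then \<alpha> else \<beta>) - of_int (r i)\<bar> < 1 / M"
    by (rule Dirichlet_approx_simult[OF M(1), of 2 "\<lambda>i. if i = 0 then \<alpha> else \<beta>"]) blast
  show thesis
    using that[OF N, of "r 0" "r 1"] r[of 0] r[of 1] M(2) by simp
qed

lemma frac_add_small:
  fixes y c :: real
  assumes "0 \<le> frac y + c" "frac y + c < 1"
  shows "frac (y + c + of_int p) = frac y + c"
  using assms unfolding frac_unique_iff by (simp add: frac_def)

text \<open>
  The orbit \<open>n (\<alpha>, \<beta>)\<close>, \<open>n \<ge> K\<close>, on the torus comes arbitrarily close to every point of the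
  orbit over the integers: adding to \<open>z\<close> a large multiple \<open>M * N\<close> of an index \<open>N\<close> with
  \<open>N (\<alpha>, \<beta>)\<close> extremely close to 0 hardly changes the point. As \<open>z \<noteq> 0\<close>, the point has
  irrational coordinates, so fractional parts do not jump nearby.
\<close>
lemma frac_recurrence:
  fixes \<alpha> \<beta> \<epsilon> :: real and z :: int and K :: nat
  assumes "\<alpha> \<notin> \<rat>" "\<beta> \<notin> \<rat>" "z \<noteq> 0" "0 < \<epsilon>"
  obtains n where "K \<le> n" "\<bar>frac (real n * \<alpha>) - frac (of_int z * \<alpha>)\<bar> < \<epsilon>"
    "\<bar>frac (real n * \<beta>) - frac (of_int z * \<beta>)\<bar> < \<epsilon>"
proof -
  define \<eta> where "\<eta> = Min {\<epsilon>, frac (of_int z * \<alpha>), 1 - frac (of_int z * \<alpha>),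
    frac (of_int z * \<beta>), 1 - frac (of_int z * \<beta>)}"
  have \<eta>: "0 < \<eta>" "\<eta> \<le> \<epsilon>" "\<eta> \<le> frac (of_int z * \<alpha>)" "\<eta> \<le> 1 - frac (of_int z * \<alpha>)"
    "\<eta> \<le> frac (of_int z * \<beta>)" "\<eta> \<le> 1 - frac (of_int z * \<beta>)"
    using assms irrational_multiple[of \<alpha> z] irrational_multiple[of \<beta> z] 
      frac_lt_1[of "of_int z * \<alpha>"] frac_lt_1[of "of_int z * \<beta>"]
    unfolding \<eta>_def by (simp_all del: frac_eq_0_iff)
  define M where "M = int K + \<bar>z\<bar> + 1"
  have M: "0 < M"
    unfolding M_def by simp
  obtain N p q where N: "0 < N" "\<bar>of_int N * \<alpha> - of_int p\<bar> < \<eta> / of_int M"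
      "\<bar>of_int N * \<beta> - of_int q\<bar> < \<eta> / of_int M"
    by (rule small_simultaneous_multiple[of "\<eta> / of_int M" \<alpha> \<beta>]) (use \<eta>(1) M in simp)
  define n where "n = nat (z + M * N)"
  have "M * 1 \<le> M * N"
    using M N(1) by (intro mult_left_mono) auto
  hence "int K \<le> z + M * N"
    using M_def by linarith
  hence n: "int n = z + M * N" "K \<le> n"
    unfolding n_def by auto
  have near: "\<bar>frac (real n * \<gamma>) - frac (of_int z * \<gamma>)\<bar> < \<epsilon>"
    if r: "\<bar>of_int N * \<gamma> - of_int r\<bar> < \<eta> / of_int M"
      and le: "\<eta> \<le> frac (of_int z * \<gamma>)" "\<eta> \<le> 1 - frac (of_int z * \<gamma>)" for \<gamma> r
  proof -
    define c where "c = of_int M * (of_int N * \<gamma> - of_int r)"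
    have "\<bar>c\<bar> = of_int M * \<bar>of_int N * \<gamma> - of_int r\<bar>"
      using M unfolding c_def abs_mult by simp
    also have "\<dots> < \<eta>"
      using r M by (simp add: field_simps)
    finally have c: "\<bar>c\<bar> < \<eta>" .
    have "real n = of_int z + of_int M * of_int N"
      using n(1) by (metis of_int_add of_int_mult of_int_of_nat_eq)
    hence "real n * \<gamma> = of_int z * \<gamma> + c + of_int (M * r)"
      unfolding c_def by (simp add: algebra_simps)
    moreover have "0 \<le> frac (of_int z * \<gamma>) + c" "frac (of_int z * \<gamma>) + c < 1"
      using c le by linarith+
    ultimately have "frac (real n * \<gamma>) = frac (of_int z * \<gamma>) + c"
      using frac_add_small by presburger
    thus ?thesis
      using c \<eta>(2) by simp
  qed
  show thesis
    using that[OF n(2)] near[OF N(2)] near[OF N(3)] \<eta> by blast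
qed

section \<open>A pair of complementary Beatty sequences\<close>

lemma crossing_step:
  fixes P :: "nat \<Rightarrow> bool"
  assumes "P 0" "\<not> P n"
  obtains k where "P k" "\<not> P (Suc k)"
  using assms by (induction n) auto

lemma twice_Min_minus_Max_ge_1_iff:
  fixes X :: "int set"
  assumes "finite X" "X \<noteq> {}"
  shows "2 * Min X - Max X \<ge> 1 \<longleftrightarrow> (\<forall>x\<in>X. \<forall>y\<in>X. y < 2 * x)"
proof
  assume "2 * Min X - Max X \<ge> 1"
  thus "\<forall>x\<in>X. \<forall>y\<in>X. y < 2 * x"
    using Min_le[OF assms(1)] Max_ge[OF assms(1)] by fastforce
next
  assume "\<forall>x\<in>X. \<forall>y\<in>X. y < 2 * x"
  hence "Max X < 2 * Min X"
    using Min_in[OF assms] Max_in[OF assms] by blast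
  thus "2 * Min X - Max X \<ge> 1"
    by simp
qed

locale beatty_pair =
  fixes \<alpha> \<beta> :: real
  assumes \<alpha>_gt: "1 < \<alpha>" and \<alpha>_less: "\<alpha> < 2" and \<alpha>_irrational: "\<alpha> \<notin> \<rat>"
    and reciprocals: "1 / \<alpha> + 1 / \<beta> = 1"
begin

abbreviation a :: "nat \<Rightarrow> nat" where "a \<equiv> beatty \<alpha>"
abbreviation b :: "nat \<Rightarrow> nat" where "b \<equiv> beatty \<beta>"

text \<open>
  Moves of the second kind are governed by the difference of the piles, so a pair matters
  through its difference \<open>d n\<close>; the increments \<open>g n\<close> are the values of the constraint function.
\<close>
definition d :: "nat \<Rightarrow> int" where "d n = int (b n) - int (a n)"
definition g :: "nat \<Rightarrow> int" where "g n = d n - d (n - 1)"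

lemma \<beta>_irrational: "\<beta> \<notin> \<rat>" and \<beta>_gt_1: "1 < \<beta>"
  using beatty_disjoint[OF \<alpha>_gt \<alpha>_less \<alpha>_irrational reciprocals, of 1 1] by auto

lemma product: "(\<alpha> - 1) * (\<beta> - 1) = 1"
  using reciprocals \<alpha>_gt \<beta>_gt_1 by (simp add: field_simps)

lemma \<beta>_eq: "\<beta> = 1 + 1 / (\<alpha> - 1)"
  using product \<alpha>_gt by (simp add: field_simps)

lemma \<beta>_gt: "2 < \<beta>"
  unfolding \<beta>_eq using \<alpha>_gt \<alpha>_less by (simp add: field_simps)

lemma int_a: "int (a n) = \<lfloor>real n * \<alpha>\<rfloor>" and int_b: "int (b n) = \<lfloor>real n * \<beta>\<rfloor>"
  unfolding beatty_def using \<alpha>_gt \<beta>_gt by simp_all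

lemma a_0 [simp]: "a 0 = 0" and b_0 [simp]: "b 0 = 0" and d_0 [simp]: "d 0 = 0"
  by (simp_all add: beatty_def d_def)

lemma a_1: "a 1 = 1"
proof -
  have "\<lfloor>\<alpha>\<rfloor> = 1"
    using \<alpha>_gt \<alpha>_less by (simp add: floor_eq_iff)
  thus ?thesis
    using int_a[of 1] by simp
qed

lemma a_Suc: "a (Suc n) = a n + 1 \<or> a (Suc n) = a n + 2"
proof -
  have "real (Suc n) * \<alpha> = real n * \<alpha> + \<alpha>"
    by (simp add: algebra_simps)
  hence "int (a (Suc n)) = int (a n) + 1 \<or> int (a (Suc n)) = int (a n) + 2"
    unfolding int_a using \<alpha>_gt \<alpha>_less by linarith
  thus ?thesis
    by linarith
qed

lemma b_Suc: "int (b (Suc n)) = int (b n) + \<lfloor>\<beta>\<rfloor> \<or> int (b (Suc n)) = int (b n) + \<lfloor>\<beta>\<rfloor> + 1"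
proof -
  have "real (Suc n) * \<beta> = real n * \<beta> + \<beta>"
    by (simp add: algebra_simps)
  thus ?thesis
    unfolding int_b by linarith
qed

lemma floor_\<beta>_ge: "2 \<le> \<lfloor>\<beta>\<rfloor>"
  using \<beta>_gt by linarith

lemma strict_mono_a: "strict_mono a"
  unfolding strict_mono_Suc_iff using a_Suc by (metis less_add_one less_add_same_cancel1 zero_less_numeral)

lemma strict_mono_b: "strict_mono b"
  unfolding strict_mono_Suc_iff
proof
  fix n show "b n < b (Suc n)"
    using b_Suc[of n] floor_\<beta>_ge by linarith
qed

lemma b_gap: 
  assumes "i < j"
  shows "int (b i) + \<lfloor>\<beta>\<rfloor> \<le> int (b j)"
proof -
  have "b (Suc i) \<le> b j"
    using assms strict_mono_b by (simp add: strict_mono_less_eq)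
  thus ?thesis
    using b_Suc[of i] by linarith
qed

lemma d_nonneg: "0 \<le> d n"
  unfolding d_def int_a int_b using \<alpha>_less \<beta>_gt
  by (simp add: floor_mono mult_left_mono)

lemma d_pos: 
  assumes "1 \<le> n"
  shows "0 < d n"
proof -
  have "a n \<noteq> b n"
    using beatty_disjoint(3)[OF \<alpha>_gt \<alpha>_less \<alpha>_irrational reciprocals assms assms] .
  thus ?thesis
    using d_nonneg[of n] unfolding d_def by linarith
qed

lemma a_eq_b_iff: "a m = b n \<longleftrightarrow> m = 0 \<and> n = 0"
proof
  assume eq: "a m = b n"
  have "m = 0" if "n = 0"
    using eq that strict_mono_a by (metis a_0 b_0 strict_mono_eq)
  moreover have "n = 0" if "m = 0"
    using eq that strict_mono_b by (metis a_0 b_0 strict_mono_eq)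
  moreover have "m = 0 \<or> n = 0"
    using beatty_disjoint(3)[OF \<alpha>_gt \<alpha>_less \<alpha>_irrational reciprocals, of m n] eq by fastforce
  ultimately show "m = 0 \<and> n = 0"
    by blast
qed auto

text \<open>
  Take the least \<open>n\<close> with \<open>k \<le> n \<alpha>\<close>. If \<open>k\<close> is not \<open>a n\<close>, then \<open>[k, k + 1]\<close> lies strictly
  between \<open>(n - 1) \<alpha>\<close> and \<open>n \<alpha>\<close>. Division by \<open>\<alpha>\<close> and \<open>1 / \<beta> = 1 - 1 / \<alpha>\<close> turn this into
  \<open>k < (k + 1 - n) \<beta> < k + 1\<close>.
\<close>
lemma beatty_cover: 
  assumes "1 \<le> k"
  obtains n where "1 \<le> n" "k = a n \<or> k = b n"
proof -
  define n where "n = nat \<lceil>real k / \<alpha>\<rceil>"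
  have k: "0 < real k / \<alpha>"
    using assms \<alpha>_gt by simp
  hence n: "1 \<le> n"
    unfolding n_def by linarith
  have n_bounds: "real k / \<alpha> \<le> real n" "real n - 1 < real k / \<alpha>"
    unfolding n_def using k by linarith+
  hence k_le: "real k \<le> real n * \<alpha>" and n_less: "(real n - 1) * \<alpha> < real k"
    using \<alpha>_gt by (simp_all add: field_simps)
  show thesis
  proof (cases "real n * \<alpha> < real k + 1")
    case True
    hence "int (a n) = int k"
      unfolding int_a using k_le by (intro floor_unique) auto
    thus thesis
      using that[OF n] by simp
  next
    case False
    have "real n * \<alpha> \<noteq> real k + 1"
    proof
      assume "real n * \<alpha> = real k + 1"
      hence "\<alpha> = (real k + 1) / real n"
        using n by (simp add: field_simps)
      thus False
        using \<alpha>_irrational by simp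
    qed
    hence "real k + 1 < real n * \<alpha>"
      using False by simp
    hence above: "(real k + 1) / \<alpha> < real n"
      using \<alpha>_gt by (simp add: field_simps)
    have \<beta>_inv: "1 / \<beta> = 1 - 1 / \<alpha>"
      using reciprocals by simp
    \<comment> \<open>the \<open>n - 1\<close> terms of the first sequence up to \<open>k\<close> leave \<open>k + 1 - n\<close> for the second\<close>
    define i where "i = k + 1 - n"
    have "real n - 1 < real k"
      using n_bounds(2) divide_left_mono[of 1 \<alpha> "real k"] \<alpha>_gt by simp
    hence n_le: "n \<le> k"
      by linarith
    hence i: "1 \<le> i" "real i = real k + 1 - real n"
      unfolding i_def by (auto simp: of_nat_diff)
    have "real k * (1 / \<beta>) < real i"
      unfolding \<beta>_inv i(2) using n_bounds(2) by (simp add: algebra_simps)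
    moreover have "real i < (real k + 1) * (1 / \<beta>)"
      unfolding \<beta>_inv i(2) using above by (simp add: algebra_simps add_divide_distrib)
    ultimately have "real k < real i * \<beta>" "real i * \<beta> < real k + 1"
      using \<beta>_gt by (simp_all add: field_simps)
    hence "int (b i) = int k"
      unfolding int_b by (intro floor_unique) auto
    thus thesis
      using that[OF i(1)] by simp
  qed
qed

lemma constraint_a: "1 \<le> n \<Longrightarrow> beatty_constraint \<alpha> \<beta> (a n) = g n"
  and constraint_b: "1 \<le> n \<Longrightarrow> beatty_constraint \<alpha> \<beta> (b n) = g n"
  using beatty_constraint_beatty[OF \<alpha>_gt \<alpha>_less \<alpha>_irrational reciprocals, of n]
  by (simp_all add: g_def d_def int_a int_b of_nat_diff)

lemma constraint_image: "beatty_constraint \<alpha> \<beta> ` {1..} = g ` {1..}"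
proof
  show "beatty_constraint \<alpha> \<beta> ` {1..} \<subseteq> g ` {1..}"
  proof
    fix z assume "z \<in> beatty_constraint \<alpha> \<beta> ` {1..}"
    then obtain k where k: "1 \<le> k" "z = beatty_constraint \<alpha> \<beta> k"
      by auto
    obtain n where "1 \<le> n" "k = a n \<or> k = b n"
      using beatty_cover[OF k(1)] .
    thus "z \<in> g ` {1..}"
      using k(2) constraint_a constraint_b by auto
  qed
  show "g ` {1..} \<subseteq> beatty_constraint \<alpha> \<beta> ` {1..}"
  proof
    fix z assume "z \<in> g ` {1..}"
    then obtain n where n: "1 \<le> n" "z = g n"
      by auto
    have "1 \<le> a n"
      using n(1) a_1 strict_mono_a by (metis strict_mono_less_eq)
    thus "z \<in> beatty_constraint \<alpha> \<beta> ` {1..}"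
      using n constraint_a by force
  qed
qed

lemma g_Suc: "g (Suc n) = (int (b (Suc n)) - int (b n)) - (int (a (Suc n)) - int (a n))"
  unfolding g_def d_def by simp

lemma g_bounds: "1 \<le> n \<Longrightarrow> \<lfloor>\<beta>\<rfloor> - 2 \<le> g n \<and> g n \<le> \<lfloor>\<beta>\<rfloor>"
  using a_Suc[of "n - 1"] b_Suc[of "n - 1"] g_Suc[of "n - 1"] by auto

lemma condition_iff:
  "2 * Min (beatty_constraint \<alpha> \<beta> ` {1..}) - Max (beatty_constraint \<alpha> \<beta> ` {1..}) \<ge> 1 \<longleftrightarrow>
    (\<forall>m\<ge>1. \<forall>n\<ge>1. g m < 2 * g n)"
  using twice_Min_minus_Max_ge_1_iff[OF finite_range_beatty_constraint[OF \<alpha>_gt \<beta>_gt_1], of "{1..}"]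
  unfolding constraint_image by auto

section \<open>The inequality makes the pairs a kernel\<close>

definition pairs :: "(nat \<times> nat) set" where
  "pairs = {(a n, b n) | n. True}"

definition kernel :: bool where
  "kernel \<longleftrightarrow> (\<forall>p. position p \<longrightarrow>
    (p \<in> pairs \<longleftrightarrow> (\<forall>q. move (beatty_constraint \<alpha> \<beta>) p q \<longrightarrow> q \<notin> pairs)))"

lemma a_le_b: "a n \<le> b n"
  using d_nonneg[of n] by (simp add: d_def)

lemma P_positions_iff_kernel: "P_positions (beatty_constraint \<alpha> \<beta>) = pairs \<longleftrightarrow> kernel"
  unfolding kernel_def
  by (rule P_positions_eq_iff_kernel) (auto simp: pairs_def position_def a_le_b)

text \<open>
  A single-pile move is seen only through the coordinate that it keeps. When the larger pile
  shrinks below \<open>x\<close>, the kept pile \<open>x\<close> becomes the larger one, which gives the disjunct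
  \<open>b j = x\<close>.
\<close>
lemma move_to_pair_iff:
  assumes "x \<le> y"
  shows "move (beatty_constraint \<alpha> \<beta>) (x, y) (a j, b j) \<longleftrightarrow>
    a j < x \<and> b j = y \<or> a j = x \<and> b j < y \<or> b j = x \<and> a j < y \<or>
    a j < x \<and> b j < y \<and> \<bar>int y - int x - d j\<bar> < beatty_constraint \<alpha> \<beta> x"
proof -
  have 1: "(\<exists>x'<x. (a j, b j) = sort_piles (x', y)) \<longleftrightarrow> a j < x \<and> b j = y"
    using assms by (auto simp: sort_piles_def min_def max_def)
  have 2: "(\<exists>y'<y. (a j, b j) = sort_piles (x, y')) \<longleftrightarrow>
      a j = x \<and> b j < y \<or> b j = x \<and> a j < y"
    using a_le_b[of j] assms by (auto simp: sort_piles_def min_def max_def)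
  have 3: "int y - int (b j) - (int x - int (a j)) = int y - int x - d j"
    by (simp add: d_def)
  show ?thesis
    unfolding move_iff[OF assms a_le_b] 1 2 3 by blast
qed

lemma strict_mono_d:
  assumes "\<And>n. 1 \<le> n \<Longrightarrow> 1 \<le> g n"
  shows "strict_mono d"
  unfolding strict_mono_Suc_iff
proof
  fix n show "d n < d (Suc n)"
    using assms[of "Suc n"] by (simp add: g_def)
qed

text \<open>
  A single-pile move would keep a coordinate, but distinct pairs share none. A move of the
  second kind to an earlier pair changes the difference by at least \<open>d n - d (n - 1)\<close>, which
  is the value of the constraint.
\<close>
lemma no_move_between_pairs:
  assumes "strict_mono d"
  shows "\<not> move (beatty_constraint \<alpha> \<beta>) (a n, b n) (a j, b j)"
proof
  assume "move (beatty_constraint \<alpha> \<beta>) (a n, b n) (a j, b j)"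
  hence both: "a j < a n" and close: "\<bar>d n - d j\<bar> < beatty_constraint \<alpha> \<beta> (a n)"
    using a_eq_b_iff[of n j] strict_mono_eq[OF strict_mono_a] strict_mono_eq[OF strict_mono_b]
    unfolding move_to_pair_iff[OF a_le_b] by (auto simp: d_def)
  have j: "j < n"
    using both strict_mono_a by (simp add: strict_mono_less)
  hence "d j \<le> d (n - 1)"
    using assms by (simp add: strict_mono_less_eq)
  thus False
    using close j constraint_a[of n] by (simp add: g_def)
qed

text \<open>
  If \<open>x\<close> is some \<open>b n\<close>, or if \<open>x = a n\<close> and \<open>b n < y\<close>, shrinking the larger pile reaches a
  pair. Otherwise \<open>x = a n \<le> y < b n\<close>, and \<open>y - x\<close> lies in some \<open>[d m, d (m + 1))\<close>. The pair
  with index \<open>m\<close> is a target if \<open>y - x\<close> is close to \<open>d m\<close>. If not, the pair with index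
  \<open>m + 1\<close> is close enough by the inequality, but one has to rule out \<open>b (m + 1) > y\<close>. This
  follows since the increments of \<open>b\<close> differ by at most 1 and those of \<open>a\<close> are at least 1.
\<close>
lemma move_to_some_pair:
  assumes cond: "\<And>m n. 1 \<le> m \<Longrightarrow> 1 \<le> n \<Longrightarrow> g m < 2 * g n"
    and xy: "x \<le> y" "(x, y) \<notin> pairs"
  obtains j where "move (beatty_constraint \<alpha> \<beta>) (x, y) (a j, b j)"
proof -
  have g_pos: "1 \<le> g n" if "1 \<le> n" for n
    using cond[OF that that] by simp
  note mono_d = strict_mono_d[OF g_pos]
  consider "x = 0" | n where "1 \<le> n" "x = b n" | n where "1 \<le> n" "x = a n" "b n < y"
    | n where "1 \<le> n" "x = a n" "y < b n"
  proof (cases "x = 0")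
    case False
    then obtain n where n: "1 \<le> n" "x = a n \<or> x = b n"
      using beatty_cover[of x] by auto
    moreover have "x = a n \<Longrightarrow> y \<noteq> b n"
      using xy(2) by (auto simp: pairs_def)
    ultimately show thesis
      using that by (metis linorder_neqE_nat)
  qed
  thus thesis
  proof cases
    case 1
    have "(a 0, b 0) \<in> pairs"
      unfolding pairs_def by blast
    hence "y \<noteq> 0"
      using 1 xy(2) by (cases "y = 0") auto
    thus thesis
      using 1 that[of 0] unfolding move_to_pair_iff[OF xy(1)] by simp
  next
    case (2 n)
    moreover have "a n < y"
      using d_pos[OF 2(1)] 2(2) xy(1) by (simp add: d_def)
    ultimately show thesis
      using that[of n] xy(1) by (simp add: move_to_pair_iff)
  next
    case (3 n)
    thus thesis
      using that[of n] xy(1) by (simp add: move_to_pair_iff)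
  next
    case (4 n)
    define D where "D = int y - int x"
    have D: "0 \<le> D" "D < d n"
      using xy(1) 4 by (auto simp: D_def d_def)
    obtain m where m: "d m \<le> D" "D < d (Suc m)"
      using crossing_step[of "\<lambda>k. d k \<le> D" n] D by (auto simp: not_le)
    have "m < n"
      using m(1) D(2) mono_d by (metis order_le_less_trans strict_mono_less)
    hence m_less: "a m < a n"
      using strict_mono_a by (simp add: strict_mono_less)
    have x_val: "beatty_constraint \<alpha> \<beta> x = g n"
      using constraint_a 4 by simp
    show thesis
    proof (cases "D - d m < g n")
      case True
      have "b m < y"
        using m(1) m_less 4(2) by (simp add: D_def d_def)
      hence "move (beatty_constraint \<alpha> \<beta>) (x, y) (a m, b m)"
        unfolding move_to_pair_iff[OF xy(1)] x_val using True m(1) m_less 4(2)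
        by (simp add: D_def)
      thus thesis
        by (rule that)
    next
      case False
      have "Suc m \<noteq> n"
        using False D(2) unfolding g_def by auto
      hence less: "Suc m < n"
        using \<open>m < n\<close> by simp
      then obtain i where i: "n = Suc i"
        by (cases n) auto
      have a_less: "a (Suc m) < a n" and "a (Suc m) \<le> a i"
        using less i strict_mono_a by (simp_all add: strict_mono_less strict_mono_less_eq)
      have "d (Suc m) - D \<le> g (Suc m) - g n"
        using False by (simp add: g_def)
      also have "\<dots> \<le> int (a n) - int (a i)"
        unfolding i g_Suc using b_Suc[of m] b_Suc[of i] a_Suc[of m] by auto
      finally have "d (Suc m) - D \<le> int (a n) - int (a (Suc m))"
        using \<open>a (Suc m) \<le> a i\<close> by linarith
      \<comment> \<open>in case of equality the pair is reached by shrinking the smaller pile\<close>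
      hence "b (Suc m) \<le> y"
        using 4(2) by (simp add: D_def d_def)
      moreover have "\<bar>D - d (Suc m)\<bar> < g n"
        using False m(2) cond[of "Suc m" n] 4(1) unfolding g_def by simp
      ultimately have "move (beatty_constraint \<alpha> \<beta>) (x, y) (a (Suc m), b (Suc m))"
        unfolding move_to_pair_iff[OF xy(1)] x_val using a_less 4(2) by (auto simp: D_def)
      thus thesis
        by (rule that)
    qed
  qed
qed

lemma kernel_if_condition:
  assumes cond: "\<And>m n. 1 \<le> m \<Longrightarrow> 1 \<le> n \<Longrightarrow> g m < 2 * g n"
  shows kernel
proof -
  have "strict_mono d"
    using cond by (intro strict_mono_d) force
  note independent = no_move_between_pairs[OF this]
  have "(\<forall>q. move (beatty_constraint \<alpha> \<beta>) (x, y) q \<longrightarrow> q \<notin> pairs) \<longleftrightarrow> (x, y) \<in> pairs"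
    if "x \<le> y" for x y
    using independent move_to_some_pair[OF cond that] unfolding pairs_def by blast
  thus ?thesis
    by (auto simp: kernel_def position_def)
qed

section \<open>A kernel of pairs, and the inequality for \<open>\<lfloor>\<beta>\<rfloor> < 4\<close>\<close>

text \<open>
  The position \<open>(a n, y)\<close> lies below the pair \<open>(a n, b n)\<close>, so shrinking the larger pile does
  not help; the two remaining kinds of move give the two alternatives.
\<close>
lemma kernel_answer:
  assumes kernel "1 \<le> n" "a n \<le> y" "y < b n"
  shows "(\<exists>j<n. b j = y) \<or> (\<exists>j<n. \<bar>int y - int (a n) - d j\<bar> < g n)"
proof -
  have "(a n, y) \<notin> pairs"
    using assms(4) strict_mono_eq[OF strict_mono_a] by (auto simp: pairs_def)
  then obtain j where "move (beatty_constraint \<alpha> \<beta>) (a n, y) (a j, b j)"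
    using assms(1,3) unfolding kernel_def position_def pairs_def by force
  hence "a j < a n \<and> b j = y \<or> a j < a n \<and> \<bar>int y - int (a n) - d j\<bar> < g n"
    using assms strict_mono_eq[OF strict_mono_a] a_eq_b_iff[of n j]
    unfolding move_to_pair_iff[OF assms(3)] constraint_a[OF assms(2)] by auto
  thus ?thesis
    using strict_mono_less[OF strict_mono_a] by blast
qed

text \<open>
  Apply \<open>kernel_answer\<close> to two piles of equal size \<open>a n\<close>: as \<open>a n\<close> is no \<open>b j\<close>, a move of the
  second kind has to exist at all.
\<close>
lemma kernel_g_pos:
  assumes kernel "1 \<le> n"
  shows "1 \<le> g n"
proof -
  have "a n < b n"
    using d_pos[OF assms(2)] by (simp add: d_def)
  moreover have "b j \<noteq> a n" for j
    using a_eq_b_iff[of n j] assms(2) by auto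
  ultimately obtain j where "\<bar>d j\<bar> < g n"
    using kernel_answer[OF assms, of "a n"] by auto
  thus ?thesis
    by linarith
qed

text \<open>
  The assumptions on \<open>D\<close> say that it lies in the gap between \<open>d (m - 1)\<close> and \<open>d m\<close>, at
  distance at least \<open>g n\<close> from both ends, hence from all values of \<open>d\<close>. Moves of the second
  kind from \<open>(a n, a n + D)\<close> are therefore useless. Such a \<open>D\<close> exists exactly if
  \<open>2 * g n \<le> g m\<close>.
\<close>
lemma kernel_gap_forces_b:
  assumes kernel "1 \<le> m" "m \<le> n"
    and D: "d (m - 1) + g n \<le> D" "D + g n \<le> d m"
  obtains i where "int (b i) = int (a n) + D"
proof -
  note mono_d = strict_mono_d[OF kernel_g_pos[OF assms(1)]]
  have g: "1 \<le> g n"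
    using kernel_g_pos assms by simp
  define y where "y = nat (int (a n) + D)"
  have "0 \<le> D"
    using D(1) d_nonneg[of "m - 1"] g by linarith
  hence y: "int y = int (a n) + D"
    by (simp add: y_def)
  have "d m \<le> d n"
    using mono_d assms(3) by (simp add: strict_mono_less_eq)
  hence "a n \<le> y" "y < b n"
    using y D(2) g \<open>0 \<le> D\<close> unfolding d_def by linarith+
  moreover have "g n \<le> \<bar>int y - int (a n) - d j\<bar>" for j
  proof (cases "j < m")
    case True
    hence "d j \<le> d (m - 1)"
      using mono_d by (simp add: strict_mono_less_eq)
    thus ?thesis
      using y D(1) by linarith
  next
    case False
    hence "d m \<le> d j"
      using mono_d by (simp add: strict_mono_less_eq)
    thus ?thesis
      using y D(2) by linarith
  qed
  ultimately obtain i where "b i = y"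
    using kernel_answer[OF assms(1), of n y] assms(2,3) by (auto simp: not_less[symmetric])
  hence "int (b i) = int (a n) + D"
    using y by simp
  thus thesis
    by (rule that)
qed

text \<open>
  If \<open>g n = 1\<close>, then \<open>a\<close> jumps by 2 before \<open>a n\<close>, so \<open>a n - 1\<close> is a value of \<open>b\<close>. As
  \<open>d 0 = 0\<close> and \<open>d 1 = 2\<close>, the number 1 lies in a gap of \<open>d\<close>, which makes \<open>a n + 1\<close> a value of
  \<open>b\<close> as well. But values of \<open>b\<close> are at least 3 apart.
\<close>
lemma no_g_1_if_floor_3:
  assumes kernel "\<lfloor>\<beta>\<rfloor> = 3" "1 \<le> n"
  shows "g n \<noteq> 1"
proof
  assume g: "g n = 1"
  have "b 1 = 3"
    using int_b[of 1] assms(2) by simp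
  hence g_1: "g 1 = 2"
    using a_1 by (simp add: g_def d_def)
  have "n \<noteq> 1"
    using g g_1 by auto
  then obtain i where i: "n = Suc i" "1 \<le> i"
    using assms(3) by (cases n) auto
  have step: "a n = a i + 2"
    using g a_Suc[of i] b_Suc[of i] assms(2) unfolding i(1) g_Suc by auto
  obtain k where k: "1 \<le> k" "a i + 1 = a k \<or> a i + 1 = b k"
    using beatty_cover[of "a i + 1"] by auto
  have "a i + 1 \<noteq> a k"
  proof
    assume "a i + 1 = a k"
    hence "a i < a k" "a k < a (Suc i)"
      using step i by auto
    hence "i < k" "k < Suc i"
      using strict_mono_less[OF strict_mono_a] by blast+
    thus False
      by simp
  qed
  hence bk: "b k = a i + 1"
    using k by simp
  obtain l where "int (b l) = int (a n) + 1"
    by (rule kernel_gap_forces_b[OF assms(1), of 1 n 1])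
       (use assms(3) g g_1 in \<open>auto simp: g_def\<close>)
  hence bl: "b l = b k + 2"
    using bk step by simp
  hence "k < l"
    using strict_mono_less[OF strict_mono_b, of k l] by simp
  from b_gap[OF this] show False
    using bl assms(2) by simp
qed

text \<open>
  Otherwise \<open>b\<close> would eventually grow with slope \<open>\<lfloor>\<beta>\<rfloor> + 1\<close>, which exceeds \<open>\<beta>\<close>.
\<close>
lemma b_step_floor_infinitely_often:
  obtains i where "k \<le> i" "int (b (Suc i)) = int (b i) + \<lfloor>\<beta>\<rfloor>"
proof -
  have "\<exists>i\<ge>k. int (b (Suc i)) = int (b i) + \<lfloor>\<beta>\<rfloor>"
  proof (rule ccontr)
    assume "\<not> ?thesis"
    hence big: "int (b (Suc i)) = int (b i) + \<lfloor>\<beta>\<rfloor> + 1" if "k \<le> i" for i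
      using b_Suc that by blast
    have grow: "int (b (k + l)) = int (b k) + int l * (\<lfloor>\<beta>\<rfloor> + 1)" for l
    proof (induction l)
      case (Suc l)
      thus ?case
        using big[of "k + l"] by (simp add: algebra_simps)
    qed simp
    have gap: "0 < of_int \<lfloor>\<beta>\<rfloor> + 1 - \<beta>"
      by linarith
    obtain l :: nat where l: "real k * \<beta> < real l * (of_int \<lfloor>\<beta>\<rfloor> + 1 - \<beta>)"
      using reals_Archimedean3[OF gap] by blast
    have "real_of_int (int (b (k + l))) \<le> real (k + l) * \<beta>"
      unfolding int_b by linarith
    hence "real (b k) + real l * (of_int \<lfloor>\<beta>\<rfloor> + 1) \<le> real (k + l) * \<beta>"
      unfolding grow by simp
    thus False
      using l by (simp add: algebra_simps)
  qed
  thus thesis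
    using that by blast
qed

text \<open>
  Suppose \<open>g m = 2\<close>. The number \<open>D = d (m - 1) + 1\<close> then forces \<open>a n + D\<close> to be a value of \<open>b\<close>
  for every \<open>n \<ge> m\<close> with \<open>g n = 1\<close>. Two consecutive such \<open>n\<close> with \<open>a (n + 1) = a n + 1\<close> give
  two values of \<open>b\<close> at distance 1, which is absurd. They are found at a late step of size 2 of
  \<open>b\<close>: since \<open>g\<close> is positive, \<open>a\<close> takes a step of size 1 there, and since \<open>\<alpha> > 3/2\<close> it takes a
  step of size 2 just before.
\<close>
lemma no_g_2_if_floor_2:
  assumes kernel "\<lfloor>\<beta>\<rfloor> = 2" "1 \<le> m"
  shows "g m \<noteq> 2"
proof
  assume g_m: "g m = 2"
  have "\<beta> < 3"
    using assms(2) by linarith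
  hence \<alpha>: "3 < 2 * \<alpha>"
  proof -
    have "1 = (\<alpha> - 1) * (\<beta> - 1)"
      using product by simp
    also have "\<dots> < (\<alpha> - 1) * 2"
      using \<open>\<beta> < 3\<close> \<alpha>_gt by (intro mult_strict_left_mono) auto
    finally show ?thesis
      by simp
  qed
  obtain i where i: "m \<le> i" "int (b (Suc i)) = int (b i) + 2"
    using b_step_floor_infinitely_often[of m] assms(2) by auto
  then obtain h where h: "i = Suc h"
    using assms(3) by (cases i) auto
  have g_pos: "1 \<le> g (Suc h)" "1 \<le> g (Suc i)"
    using kernel_g_pos[OF assms(1)] by simp_all
  have step: "a (Suc i) = a i + 1"
    using g_pos(2) i(2) a_Suc[of i] unfolding g_Suc by auto
  have "real (Suc i) * \<alpha> = real h * \<alpha> + 2 * \<alpha>"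
    unfolding h by (simp add: algebra_simps)
  hence "int (a (Suc i)) \<ge> int (a h) + 3"
    unfolding int_a using \<alpha> by linarith
  hence "a i = a h + 2"
    using step a_Suc[of h] h by auto
  hence g_i: "g i = 1"
    using g_pos(1) b_Suc[of h] assms(2) unfolding h g_Suc by auto
  have g_Suc_i: "g (Suc i) = 1"
    unfolding g_Suc using step i(2) by simp
  define D where "D = d (m - 1) + 1"
  have D: "d (m - 1) + 1 \<le> D" "D + 1 \<le> d m"
    using g_m unfolding D_def g_def by auto
  obtain k where k: "int (b k) = int (a i) + D"
    using kernel_gap_forces_b[OF assms(1,3) i(1)] D unfolding g_i by blast
  obtain l where l: "int (b l) = int (a (Suc i)) + D"
    using kernel_gap_forces_b[OF assms(1,3), of "Suc i" D] D i(1) unfolding g_Suc_i by auto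
  have "b l = b k + 1"
    using k l step by simp
  moreover from this have "k < l"
    using strict_mono_less[OF strict_mono_b, of k l] by simp
  ultimately show False
    using b_gap[of k l] assms(2) by simp
qed

section \<open>The inequality for \<open>\<lfloor>\<beta>\<rfloor> = 4\<close>\<close>

lemma frac_a: "frac (real n * \<alpha>) = real n * \<alpha> - real (a n)"
  and frac_b: "frac (real n * \<beta>) = real n * \<beta> - real (b n)"
  using int_a[of n] int_b[of n] unfolding frac_def by (metis of_int_of_nat_eq)+

text \<open>
  The value 4 is taken exactly if \<open>a\<close> takes its short and \<open>b\<close> its long step. Strictness of the
  second inequality is free because \<open>\<beta>\<close> is irrational, and it makes the condition an open one.
\<close>
lemma g_eq_4_iff:
  assumes "\<lfloor>\<beta>\<rfloor> = 4"
  shows "g (Suc n) = 4 \<longleftrightarrow> frac (real n * \<alpha>) < 2 - \<alpha> \<and> 5 - \<beta> < frac (real n * \<beta>)"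
proof -
  have "real (Suc n) * \<alpha> < real (a n) + 2 \<longleftrightarrow> a (Suc n) = a n + 1"
    using a_Suc[of n] int_a[of "Suc n"] by (auto simp: floor_eq_iff; linarith)
  moreover have "real (b n) + 5 < real (Suc n) * \<beta> \<longleftrightarrow> int (b (Suc n)) = int (b n) + 5"
    using beatty_strict[OF \<beta>_gt_1 \<beta>_irrational, of "Suc n"] b_Suc[of n] assms by auto
  moreover have "g (Suc n) = 4 \<longleftrightarrow> a (Suc n) = a n + 1 \<and> int (b (Suc n)) = int (b n) + 5"
    unfolding g_Suc using a_Suc[of n] b_Suc[of n] assms by auto
  ultimately show ?thesis
    unfolding frac_a frac_b by (simp add: algebra_simps)
qed

text \<open>
  The value 2 is taken exactly if \<open>a\<close> takes its long and \<open>b\<close> its short step. For \<open>n = 1\<close> the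
  second fractional part would be exactly \<open>\<beta> - 4\<close>, and \<open>g 1 = 3\<close>.
\<close>
lemma g_eq_2_iff:
  assumes "\<lfloor>\<beta>\<rfloor> = 4" "2 \<le> n"
  shows "g n = 2 \<longleftrightarrow> frac (real n * \<alpha>) < \<alpha> - 1 \<and> \<beta> - 4 < frac (real n * \<beta>)"
proof -
  obtain i where i: "n = Suc i" "1 \<le> i"
    using assms(2) by (cases n) auto
  have "real i * \<alpha> < real (a n) - 1 \<longleftrightarrow> a n = a i + 2"
    using beatty_strict[OF \<alpha>_gt \<alpha>_irrational i(2)] a_Suc[of i] unfolding i(1) by auto
  moreover have "real (b n) - 4 < real i * \<beta> \<longleftrightarrow> int (b n) = int (b i) + 4"
    using beatty_strict[OF \<beta>_gt_1 \<beta>_irrational i(2)] b_Suc[of i] assms(1) unfolding i(1) by auto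
  moreover have "g n = 2 \<longleftrightarrow> a n = a i + 2 \<and> int (b n) = int (b i) + 4"
    unfolding i(1) g_Suc using a_Suc[of i] b_Suc[of i] assms by auto
  ultimately show ?thesis
    unfolding frac_a frac_b using i(1) by (simp add: algebra_simps)
qed

text \<open>
  For \<open>D = d m + 2\<close> there is \<open>i\<close> with \<open>b i = a n + D\<close>. By \<open>\<alpha> \<beta> = \<alpha> + \<beta>\<close>, writing \<open>a n\<close>, \<open>a m\<close>
  and \<open>b m\<close> through the fractional parts turns this into \<open>i \<beta> - b i = z \<beta> + w\<close> for an integer
  \<open>z\<close>. The left side is the fractional part of \<open>i \<beta>\<close>, and \<open>w\<close> is too small for any \<open>z\<close> other
  than 0.
\<close>
lemma kernel_window:
  assumes kernel "\<lfloor>\<beta>\<rfloor> = 4" "m < n" and gs: "g (Suc m) = 4" "g n = 2"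
  defines "w \<equiv> (\<beta> - 1) * frac (real m * \<alpha>) + frac (real m * \<beta>) - 2 - (\<beta> - 1) * frac (real n * \<alpha>)"
  shows "0 \<le> w"
proof -
  have \<beta>: "4 \<le> \<beta>" "\<beta> < 5"
    using assms(2) by linarith+
  have "g 1 = 3"
    using a_1 int_b[of 1] assms(2) by (simp add: g_def d_def)
  hence n: "2 \<le> n"
    using assms(3) gs(2) by (cases "n = 1") auto
  have "d m + 2 + g n \<le> d (Suc m)"
    using gs by (simp add: g_def)
  then obtain i where i: "int (b i) = int (a n) + (d m + 2)"
    using kernel_gap_forces_b[OF assms(1), of "Suc m" n "d m + 2"] assms(3) gs(2) by auto
  have "(\<beta> - 1) * frac (real m * \<alpha>) < (\<beta> - 1) * (2 - \<alpha>)"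
    using g_eq_4_iff[OF assms(2)] gs(1) \<beta> by (intro mult_strict_left_mono) auto
  also have "\<dots> = \<beta> - 2"
    using product by (simp add: algebra_simps)
  finally have e: "(\<beta> - 1) * frac (real m * \<alpha>) < \<beta> - 2" "0 \<le> (\<beta> - 1) * frac (real m * \<alpha>)"
    using \<beta> by simp_all
  have "(\<beta> - 1) * frac (real n * \<alpha>) < (\<beta> - 1) * (\<alpha> - 1)"
    using g_eq_2_iff[OF assms(2) n] gs(2) \<beta> by (intro mult_strict_left_mono) auto
  hence x: "(\<beta> - 1) * frac (real n * \<alpha>) < 1" "0 \<le> (\<beta> - 1) * frac (real n * \<alpha>)"
    using product \<beta> by (simp_all add: mult.commute)
  have w: "-3 < w" "w < 2"
    unfolding w_def using e x \<beta> frac_lt_1[of "real m * \<beta>"] frac_ge_0[of "real m * \<beta>"]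
    by linarith+
  define z where "z = int i + int n + int (a m) - int (a n) - 2 * int m"
  have prod: "\<alpha> * \<beta> = \<alpha> + \<beta>"
    using product by (simp add: algebra_simps)
  have "real i * \<beta> - real (b i) = of_int z * \<beta> + w"
  proof -
    have bi: "real (b i) = real (a n) + real (b m) - real (a m) + 2"
      using i unfolding d_def by linarith
    have "(\<beta> - 1) * (real m * \<alpha>) = real m * (\<alpha> * \<beta> - \<alpha>)"
      by (simp add: algebra_simps)
    hence m: "(\<beta> - 1) * (real m * \<alpha>) = real m * \<beta>"
      unfolding prod by simp
    have "(\<beta> - 1) * (real n * \<alpha>) = real n * (\<alpha> * \<beta> - \<alpha>)"
      by (simp add: algebra_simps)
    hence n: "(\<beta> - 1) * (real n * \<alpha>) = real n * \<beta>"
      unfolding prod by simp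
    show ?thesis
      unfolding w_def frac_a frac_b right_diff_distrib m n bi z_def by (simp add: algebra_simps)
  qed
  moreover have "0 \<le> real i * \<beta> - real (b i)" "real i * \<beta> - real (b i) < 1"
    using frac_ge_0[of "real i * \<beta>"] frac_lt_1[of "real i * \<beta>"] unfolding frac_b by simp_all
  ultimately have zw: "0 \<le> of_int z * \<beta> + w" "of_int z * \<beta> + w < 1"
    by simp_all
  have "z = 0"
  proof (rule ccontr)
    assume "z \<noteq> 0"
    then consider "1 \<le> z" | "z \<le> -1"
      by linarith
    thus False
    proof cases
      case 1
      hence "1 * 4 \<le> of_int z * \<beta>"
        using \<beta> by (intro mult_mono) auto
      thus False
        using zw w by linarith
    next
      case 2
      hence "1 * 4 \<le> (- of_int z) * \<beta>"
        using \<beta> by (intro mult_mono) auto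
      thus False
        using zw w by simp
    qed
  qed
  thus ?thesis
    using zw by simp
qed

text \<open>
  Natural indices \<open>m\<close> and \<open>n\<close> with \<open>m + 2 \<le> n\<close> can be chosen so that their points on the torus
  are close to those of \<open>z'\<close> and \<open>z\<close>. The conditions on the points are open and carry over, and
  the inequality survives the limit.
\<close>
lemma kernel_window_int:
  fixes z z' :: int
  assumes kernel "\<lfloor>\<beta>\<rfloor> = 4"
    and z': "frac (of_int z' * \<alpha>) < 2 - \<alpha>" "5 - \<beta> < frac (of_int z' * \<beta>)"
    and z: "frac (of_int z * \<alpha>) < \<alpha> - 1" "\<beta> - 4 < frac (of_int z * \<beta>)"
  defines "w \<equiv> (\<beta> - 1) * frac (of_int z' * \<alpha>) + frac (of_int z' * \<beta>) - 2
    - (\<beta> - 1) * frac (of_int z * \<alpha>)"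
  shows "0 \<le> w"
proof -
  have \<beta>: "4 \<le> \<beta>" "\<beta> < 5"
    using assms(2) by linarith+
  have nonzero: "z \<noteq> 0" "z' \<noteq> 0"
    using z(2) z'(2) \<beta> by auto
  have approx: "0 \<le> w + \<eta>" if \<eta>: "0 < \<eta>" for \<eta>
  proof -
    \<comment> \<open>\<open>9 = 4 + 4 + 1\<close>: two of the three terms of \<open>w\<close> carry the factor \<open>\<beta> - 1 < 4\<close>\<close>
    define \<epsilon> where "\<epsilon> = Min {\<eta> / 9, 2 - \<alpha> - frac (of_int z' * \<alpha>), frac (of_int z' * \<beta>) - (5 - \<beta>),
      \<alpha> - 1 - frac (of_int z * \<alpha>), frac (of_int z * \<beta>) - (\<beta> - 4)}"
    have \<epsilon>: "0 < \<epsilon>" "9 * \<epsilon> \<le> \<eta>" "\<epsilon> \<le> 2 - \<alpha> - frac (of_int z' * \<alpha>)"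
      "\<epsilon> \<le> frac (of_int z' * \<beta>) - (5 - \<beta>)" "\<epsilon> \<le> \<alpha> - 1 - frac (of_int z * \<alpha>)"
      "\<epsilon> \<le> frac (of_int z * \<beta>) - (\<beta> - 4)"
      using \<eta> z z' unfolding \<epsilon>_def by (simp_all add: min_def)
    obtain m where m: "\<bar>frac (real m * \<alpha>) - frac (of_int z' * \<alpha>)\<bar> < \<epsilon>"
        "\<bar>frac (real m * \<beta>) - frac (of_int z' * \<beta>)\<bar> < \<epsilon>"
      using frac_recurrence[OF \<alpha>_irrational \<beta>_irrational nonzero(2) \<epsilon>(1), of 0] by metis
    obtain n where n: "m + 2 \<le> n" "\<bar>frac (real n * \<alpha>) - frac (of_int z * \<alpha>)\<bar> < \<epsilon>"
        "\<bar>frac (real n * \<beta>) - frac (of_int z * \<beta>)\<bar> < \<epsilon>"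
      using frac_recurrence[OF \<alpha>_irrational \<beta>_irrational nonzero(1) \<epsilon>(1), of "m + 2"] by metis
    have "g (Suc m) = 4"
      unfolding g_eq_4_iff[OF assms(2)] using m \<epsilon> by linarith
    moreover have "g n = 2"
      using n \<epsilon> by (subst g_eq_2_iff[OF assms(2)]) linarith+
    ultimately have window:
      "0 \<le> (\<beta> - 1) * frac (real m * \<alpha>) + frac (real m * \<beta>) - 2 - (\<beta> - 1) * frac (real n * \<alpha>)"
      using kernel_window[OF assms(1,2), of m n] n(1) by simp
    have scaled: "\<bar>(\<beta> - 1) * x - (\<beta> - 1) * y\<bar> \<le> 4 * \<epsilon>" if "\<bar>x - y\<bar> < \<epsilon>" for x y
      unfolding right_diff_distrib[symmetric] abs_mult using that \<beta> by (intro mult_mono) auto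
    show ?thesis
      unfolding w_def using window scaled[OF m(1)] m(2) scaled[OF n(2)] \<epsilon>(2) by linarith
  qed
  show ?thesis
    by (rule field_le_epsilon) (use approx in force)
qed

text \<open>
  Call an integer index of type 4 or 2 if its point \<open>(u, v)\<close> on the torus lies in the rectangle
  of \<open>g_eq_4_iff\<close> or \<open>g_eq_2_iff\<close>. Let \<open>N\<close> be an index whose point is \<open>(\<epsilon>1, \<epsilon>2)\<close>
  modulo 1, with both numbers tiny and \<open>\<epsilon>1 > 0\<close>. With \<open>t = \<beta> - 1\<close>, so that \<open>(\<alpha> - 1) t = 1\<close>, every point \<open>(u', v')\<close> of type 4 and
  every point \<open>(u, v)\<close> of type 2 satisfy \<open>t u \<le> t u' + v' - 2\<close>.

  If \<open>\<epsilon>2 < 0\<close>, then \<open>N\<close> itself is of type 4 with a right side close to -1, while the left side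
  is never negative.
  If \<open>\<epsilon>2 > 0\<close>, add multiples of \<open>N\<close> to an index of type 2. Both coordinates grow, and the type
  persists until \<open>u\<close> is about to reach \<open>\<alpha> - 1\<close> or \<open>v\<close> is about to reach 1. In the second case
  the point is also of type 4 and violates the inequality with itself. In the first case \<open>t u\<close>
  is almost 1, so all points of type 4 have \<open>t u' + v'\<close> almost at least 3. Now subtract
  multiples of \<open>N\<close> from an index of type 4. Again the type persists until \<open>u'\<close> is about to
  reach 0 or \<open>v'\<close> is about to reach \<open>5 - \<beta>\<close>, and in both cases \<open>t u' + v'\<close> is too small.
\<close>
lemma not_g_2_and_g_4_if_floor_4:
  assumes kernel "\<lfloor>\<beta>\<rfloor> = 4" "1 \<le> m" "1 \<le> n" "g m = 4" "g n = 2"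
  shows False
proof -
  define t where "t = \<beta> - 1"
  define u where "u z = frac (of_int z * \<alpha>)" for z :: int
  define v where "v z = frac (of_int z * \<beta>)" for z :: int
  define two where "two z \<longleftrightarrow> u z < \<alpha> - 1 \<and> \<beta> - 4 < v z" for z
  define four where "four z \<longleftrightarrow> u z < 2 - \<alpha> \<and> 5 - \<beta> < v z" for z
  have window: "t * u z \<le> t * u z' + v z' - 2" if "four z'" "two z" for z z'
    using kernel_window_int[OF assms(1,2)] that unfolding four_def two_def u_def v_def t_def 
    by force
  have "\<beta> \<noteq> 4"
    using \<beta>_irrational by auto
  hence \<beta>: "4 < \<beta>" "\<beta> < 5"
    using assms(2) by linarith+
  have \<alpha>: "(\<alpha> - 1) * t = 1"
    using product by (simp add: t_def)
  have "3 * (\<alpha> - 1) < t * (\<alpha> - 1)"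
    using \<alpha>_gt \<beta> by (intro mult_strict_right_mono) (auto simp: t_def)
  hence \<alpha>_less: "3 * \<alpha> < 4"
    using \<alpha> by (simp add: mult.commute)
  have u: "0 \<le> u z" and v: "v z < 1" for z
    by (simp_all add: u_def v_def frac_lt_1)
  have "g 1 = 3"
    using a_1 int_b[of 1] assms(2) by (simp add: g_def d_def)
  hence "2 \<le> n"
    using assms(4,6) by (cases "n = 1") auto
  hence "two (int n)"
    unfolding two_def u_def v_def using g_eq_2_iff[OF assms(2)] assms(6) by simp
  then obtain z2 where z2: "two z2" ..
  have "g (Suc (m - 1)) = 4"
    using assms(3,5) by simp
  hence "four (int (m - 1))"
    unfolding four_def u_def v_def g_eq_4_iff[OF assms(2)] by simp
  then obtain z4 where z4: "four z4" ..
  \<comment> \<open>the distance of \<open>t * u z4\<close> to its upper bound \<open>t (2 - \<alpha>) = t - 1\<close>\<close>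
  define \<sigma> where "\<sigma> = t - 1 - t * u z4"
  have "t * u z4 < t * (2 - \<alpha>)"
    using z4 \<beta> unfolding four_def t_def by (intro mult_strict_left_mono) auto
  also have "\<dots> = t - 1"
    using \<alpha> by (simp add: algebra_simps)
  finally have \<sigma>: "0 < \<sigma>"
    unfolding \<sigma>_def by simp
  define \<epsilon> where "\<epsilon> = Min {1 / 4, \<beta> - 4, \<sigma> / 5}"
  have \<epsilon>: "0 < \<epsilon>" "\<epsilon> \<le> 1 / 4" "\<epsilon> \<le> \<beta> - 4" "5 * \<epsilon> \<le> \<sigma>"
    unfolding \<epsilon>_def using \<beta> \<sigma> by (simp_all add: min_def)
  obtain N p q where N: "N \<noteq> 0" "0 < of_int N * \<alpha> - of_int p" "of_int N * \<alpha> - of_int p < \<epsilon>"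
    "\<bar>of_int N * \<beta> - of_int q\<bar> < \<epsilon>"
  proof -
    obtain N p q where N: "0 < N" "\<bar>of_int N * \<alpha> - of_int p\<bar> < \<epsilon>" "\<bar>of_int N * \<beta> - of_int q\<bar> < \<epsilon>"
      using small_simultaneous_multiple[OF \<epsilon>(1)] .
    have "of_int N * \<alpha> \<noteq> of_int p"
      using irrational_multiple[OF \<alpha>_irrational, of N] N(1) by auto
    then consider "0 < of_int N * \<alpha> - of_int p" | "of_int N * \<alpha> - of_int p < 0"
      by linarith
    thus thesis
      using that[of N p q] that[of "- N" "- p" "- q"] N by cases auto
  qed
  define \<epsilon>1 where "\<epsilon>1 = of_int N * \<alpha> - of_int p"
  define \<epsilon>2 where "\<epsilon>2 = of_int N * \<beta> - of_int q"
  have \<epsilon>1: "0 < \<epsilon>1" "\<epsilon>1 < \<epsilon>" and \<epsilon>2: "\<bar>\<epsilon>2\<bar> < \<epsilon>"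
    using N unfolding \<epsilon>1_def \<epsilon>2_def by auto
  have "of_int N * \<beta> \<noteq> of_int q"
    using irrational_multiple[OF \<beta>_irrational N(1)] by auto
  hence "\<epsilon>2 \<noteq> 0"
    by (simp add: \<epsilon>2_def)
  have shift_u: "u (z + k * N) = u z + of_int k * \<epsilon>1" 
    if "0 \<le> u z + of_int k * \<epsilon>1" "u z + of_int k * \<epsilon>1 < 1" for z k
  proof -
    have "of_int (z + k * N) * \<alpha> = of_int z * \<alpha> + of_int k * \<epsilon>1 + of_int (k * p)"
      unfolding \<epsilon>1_def by (simp add: algebra_simps)
    thus ?thesis
      using frac_add_small[OF that[unfolded u_def]] by (simp only: u_def)
  qed
  have shift_v: "v (z + k * N) = v z + of_int k * \<epsilon>2" 
    if "0 \<le> v z + of_int k * \<epsilon>2" "v z + of_int k * \<epsilon>2 < 1" for z k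
  proof -
    have "of_int (z + k * N) * \<beta> = of_int z * \<beta> + of_int k * \<epsilon>2 + of_int (k * q)"
      unfolding \<epsilon>2_def by (simp add: algebra_simps)
    thus ?thesis
      using frac_add_small[OF that[unfolded v_def]] by (simp only: v_def)
  qed
  have "t * \<epsilon>1 < 4 * (1 / 4)"
    using \<beta> \<epsilon>1 \<epsilon> by (intro mult_strict_mono) (auto simp: t_def)
  hence t\<epsilon>1: "t * \<epsilon>1 < 1"
    by simp
  have "t * \<epsilon>1 \<le> 4 * \<epsilon>"
    using \<beta> \<epsilon>1 \<epsilon> by (intro mult_mono) (auto simp: t_def)
  hence t\<epsilon>: "t * \<epsilon>1 + \<bar>\<epsilon>2\<bar> < 5 * \<epsilon>"
    using \<epsilon>2 by simp
  have no_four: "\<not> four z" if "t * u z + v z < 2" for z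
  proof
    assume "four z"
    moreover have "0 \<le> t * u z2"
      using u[of z2] \<beta> by (simp add: t_def)
    ultimately show False
      using window[OF _ z2, of z] that by linarith
  qed
  show False
  proof (cases "\<epsilon>2 < 0")
    case True
    have N_u: "u N = \<epsilon>1"
      unfolding u_def \<epsilon>1_def frac_unique_iff using \<epsilon>1 \<epsilon> by (simp add: \<epsilon>1_def)
    have N_v: "v N = 1 + \<epsilon>2"
      unfolding v_def \<epsilon>2_def frac_unique_iff using \<epsilon>2 \<epsilon> True by (simp add: \<epsilon>2_def)
    have "four N"
      unfolding four_def N_u N_v using \<epsilon>1 \<epsilon> \<epsilon>2 \<alpha>_less by auto
    thus False
      using no_four[of N] t\<epsilon>1 True unfolding N_u N_v by simp
  next
    case False
    hence \<epsilon>2_pos: "0 < \<epsilon>2" "\<epsilon>2 < \<epsilon>"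
      using \<open>\<epsilon>2 \<noteq> 0\<close> \<epsilon>2 by auto
    obtain K :: nat where K: "1 < real K * \<epsilon>1"
      using reals_Archimedean3[OF \<epsilon>1(1)] by blast
    \<comment> \<open>the point of type 2 after \<open>k\<close> steps forwards, not yet wrapped around\<close>
    define ahead where "ahead k \<longleftrightarrow> u z2 + real k * \<epsilon>1 < \<alpha> - 1 \<and> v z2 + real k * \<epsilon>2 < 1" for k
    have "ahead 0"
      using z2 v by (simp add: ahead_def two_def)
    moreover have "\<not> ahead K"
      using u[of z2] K \<alpha>_less unfolding ahead_def by linarith
    ultimately obtain k where k: "ahead k" "\<not> ahead (Suc k)"
      by (rule crossing_step)
    define y2 where "y2 = z2 + int k * N"
    have "0 \<le> real k * \<epsilon>1" "0 \<le> real k * \<epsilon>2"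
      using \<epsilon>1 \<epsilon>2_pos by simp_all
    hence y2: "u y2 = u z2 + real k * \<epsilon>1" "v y2 = v z2 + real k * \<epsilon>2" "two y2"
      using shift_u[of z2 "int k"] shift_v[of z2 "int k"] k(1) u[of z2] z2 \<alpha>_less \<beta>
      unfolding y2_def two_def ahead_def by auto
    have "\<not> 1 \<le> v y2 + \<epsilon>2"
    proof
      assume "1 \<le> v y2 + \<epsilon>2"
      hence "four y2"
        using y2 \<epsilon>2_pos \<epsilon> \<alpha>_less unfolding four_def two_def by auto
      thus False
        using window[OF _ y2(3), of y2] v[of y2] by simp
    qed
    hence "\<alpha> - 1 \<le> u y2 + \<epsilon>1"
      using k(2) unfolding y2 ahead_def by (simp add: algebra_simps)
    hence "t * (\<alpha> - 1) \<le> t * (u y2 + \<epsilon>1)"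
      using \<beta> by (intro mult_left_mono) (auto simp: t_def)
    hence far: "1 - t * \<epsilon>1 \<le> t * u y2"
      using \<alpha> by (simp add: algebra_simps)
    \<comment> \<open>the point of type 4 after \<open>l\<close> steps backwards, still of that type\<close>
    define behind where "behind l \<longleftrightarrow> 0 \<le> u z4 - real l * \<epsilon>1 \<and> 5 - \<beta> < v z4 - real l * \<epsilon>2" for l
    have "behind 0"
      using z4 u by (simp add: behind_def four_def)
    moreover have "\<not> behind K"
      using K frac_lt_1[of "of_int z4 * \<alpha>"] unfolding behind_def u_def by linarith
    ultimately obtain l where l: "behind l" "\<not> behind (Suc l)"
      by (rule crossing_step)
    define y4 where "y4 = z4 + (- int l) * N"
    have "0 \<le> real l * \<epsilon>1" "0 \<le> real l * \<epsilon>2"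
      using \<epsilon>1 \<epsilon>2_pos by simp_all
    hence y4: "u y4 = u z4 - real l * \<epsilon>1" "v y4 = v z4 - real l * \<epsilon>2" "four y4"
      using shift_u[of z4 "- int l"] shift_v[of z4 "- int l"] l(1) v[of z4] z4 \<alpha>_gt \<beta>
      unfolding y4_def four_def behind_def by auto
    have gap: "3 - t * \<epsilon>1 \<le> t * u y4 + v y4"
      using window[OF y4(3) y2(3)] far by simp
    from l(2) consider "u y4 < \<epsilon>1" | "v y4 \<le> 5 - \<beta> + \<epsilon>2"
      unfolding y4 behind_def de_Morgan_conj not_le not_less by (auto simp: algebra_simps)
    thus False
    proof cases
      case 1
      hence "t * u y4 \<le> t * \<epsilon>1"
        using \<beta> by (intro mult_left_mono) (auto simp: t_def)
      thus False
        using gap t\<epsilon>1 v[of y4] by simp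
    next
      case 2
      have "t * u y4 \<le> t * u z4"
        using y4(1) \<open>0 \<le> real l * \<epsilon>1\<close> \<beta> by (intro mult_left_mono) (auto simp: t_def)
      hence "t * u y4 \<le> t - 1 - \<sigma>"
        by (simp add: \<sigma>_def)
      thus False
        using gap 2 t\<epsilon> \<epsilon>(4) \<epsilon>2_pos unfolding t_def by linarith
    qed
  qed
qed

text \<open>
  From \<open>2 * g n \<le> g m\<close>, \<open>g n \<ge> \<lfloor>\<beta>\<rfloor> - 2\<close> and \<open>g m \<le> \<lfloor>\<beta>\<rfloor>\<close> it follows that \<open>\<lfloor>\<beta>\<rfloor> \<le> 4\<close>, and
  positivity of \<open>g n\<close> leaves the three cases treated above.
\<close>
lemma condition_if_kernel:
  assumes kernel "1 \<le> m" "1 \<le> n"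
  shows "g m < 2 * g n"
proof (rule ccontr)
  assume "\<not> g m < 2 * g n"
  hence le: "2 * g n \<le> g m"
    by simp
  have n: "1 \<le> g n" "\<lfloor>\<beta>\<rfloor> - 2 \<le> g n" and m: "g m \<le> \<lfloor>\<beta>\<rfloor>"
    using kernel_g_pos[OF assms(1,3)] g_bounds assms by auto
  consider "\<lfloor>\<beta>\<rfloor> = 2" "g m = 2" | "\<lfloor>\<beta>\<rfloor> = 3" "g n = 1" | "\<lfloor>\<beta>\<rfloor> = 4" "g m = 4" "g n = 2"
    using le n m floor_\<beta>_ge by linarith
  thus False
    using no_g_2_if_floor_2[OF assms(1) _ assms(2)] no_g_1_if_floor_3[OF assms(1) _ assms(3)]
      not_g_2_and_g_4_if_floor_4[OF assms(1) _ assms(2,3)] by cases auto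
qed

end

theorem lemma7:
  fixes \<alpha> \<beta> :: real and f :: "nat \<Rightarrow> int"
  assumes "1 < \<alpha>" and "\<alpha> < 2" and "\<alpha> \<notin> \<rat>"
    and "1 / \<alpha> + 1 / \<beta> = 1"
    and "f = beatty_constraint \<alpha> \<beta>"
  shows "P_positions f = {(beatty \<alpha> n, beatty \<beta> n) | n :: nat. True} \<longleftrightarrow>
    2 * Min (f ` {1..}) - Max (f ` {1..}) \<ge> 1"
proof -
  interpret beatty_pair \<alpha> \<beta>
    using assms(1-4) by unfold_locales
  have "P_positions f = pairs \<longleftrightarrow> kernel"
    unfolding assms(5) by (rule P_positions_iff_kernel)
  also have "kernel \<longleftrightarrow> (\<forall>m\<ge>1. \<forall>n\<ge>1. g m < 2 * g n)"
    using kernel_if_condition condition_if_kernel by blast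
  also have "\<dots> \<longleftrightarrow> 2 * Min (f ` {1..}) - Max (f ` {1..}) \<ge> 1"
    unfolding assms(5) condition_iff ..
  finally show ?thesis
    unfolding pairs_def .
qed

end
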